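(* Consider the distance estimator $\widehat r$ computed from the adjacency matrix $A$ of a $W$-random graph on $n$ nodes. Then, for any graphon $(\Omega,\mu,W)$, with probability at least $1-2/n$ one has $$\forall i,j\in[n],\qquad \left| r_W^2(\omega_i,\omega_j)-\widehat r^{\,2}(i,j)\right|\lesssim r_W(\omega_j,\omega_{m(j)})+r_W(\omega_i,\omega_{m(i)})+\sqrt{\frac{\log n}{n}} .$$
   Context: A graphon is a triplet $(\Omega,\mu,W)$ where $\Omega$ is a measurable space, $\mu$ is a probability measure on $\Omega$ and $W:\Omega\times\Omega\to[0,1]$ is a symmetric measurable function. Neighborhood distance (a pseudo-metric on $\Omega$): $r_W(\omega,\omega')=\big(\int_\Omega |W(\omega,z)-W(\omega',z)|^2\mu(dz)\big)^{1/2}$. The notation $a\lesssim b$ means that there exists a constant $C$ such that $a\le Cb$. $[n]=\{1,\dots,n\}$. $W$-random graph model on $n$ nodes with parameter $(\Omega,\mu,W)$: $\omega_1,\dots,\omega_n$ are i.i.d. with law $\mu$ (unobserved); conditionally on $(\omega_1,\dots,\omega_n)$, the entries $A_{ij}$, $i<j$, are independent Bernoulli variables with parameters $W(\omega_i,\omega_j)$; $A_{ji}=A_{ij}$ and $A_{ii}=0$. The probability in the claim is with respect to this model. For each $i\in[n]$, $\omega_{m(i)}\in\{\omega_1,\dots,\omega_n\}\setminus\{\omega_i\}$ denotes a nearest neighbor of $\omega_i$ for $r_W$, i.e. $m(i)\in\operatorname{argmin}_{t\ne i} r_W(\omega_i,\omega_t)$. Distance estimator: with $A_i$ the $i$-th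 row of $A$ and $\langle A_i,A_j\rangle_n=\frac1n\sum_{k=1}^n A_{ik}A_{jk}$, put $\widehat f(i,j)=\max_{k\ne i,j}|\langle A_k,A_i-A_j\rangle_n|$ and $\widehat m(i)\in\operatorname{argmin}_{j\ne i}\widehat f(i,j)$. Then, for all $i,j\in[n]$, $$\widehat r^{\,2}(i,j)=\langle A_i,A_{\widehat m(i)}\rangle_n+\langle A_j,A_{\widehat m(j)}\rangle_n-2\langle A_i,A_j\rangle_n .$$
   Formalization: The bound is for i ≠ j only: at i = j it fails, e.g. for W = 1/2, where the estimator tends to -1/2 while r_W = 0 and the right side tends to 0. The constant is uniform over graphons on one fixed underlying type; taking the reals covers all graphons by pullback. *)

theory Defs
  imports "HOL-Probability.Probability"
begin

locale graphon = prob_space M for M :: "'a measure" +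
  fixes W :: "'a \<Rightarrow> 'a \<Rightarrow> real"
  assumes measurable_W: "(\<lambda>(x, y). W x y) \<in> borel_measurable (M \<Otimes>\<^sub>M M)"
    and range_W: "\<And>x y. x \<in> space M \<Longrightarrow> y \<in> space M \<Longrightarrow> W x y \<in> {0..1}"
    and sym_W: "\<And>x y. x \<in> space M \<Longrightarrow> y \<in> space M \<Longrightarrow> W x y = W y x"

definition neighborhood_dist :: "'a measure \<Rightarrow> ('a \<Rightarrow> 'a \<Rightarrow> real) \<Rightarrow> 'a \<Rightarrow> 'a \<Rightarrow> real" where
  "neighborhood_dist M W x y = sqrt (\<integral>z. \<bar>W x z - W y z\<bar>\<^sup>2 \<partial>M)"


text \<open>
  Nodes are numbered from \<open>1\<close> to \<open>n\<close>, and the sampled matrix almost surely vanishes outside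
  \<open>{1..n} \<times> {1..n}\<close>.
\<close>

definition edge_pairs :: "nat \<Rightarrow> (nat \<times> nat) set" where
  "edge_pairs n = {(i, j). 1 \<le> i \<and> i < j \<and> j \<le> n}"

definition adjacency_matrix :: "(nat \<times> nat \<Rightarrow> bool) \<Rightarrow> nat \<Rightarrow> nat \<Rightarrow> real" where
  "adjacency_matrix e i j =
     (if i < j then of_bool (e (i, j)) else if j < i then of_bool (e (j, i)) else 0)"

text \<open>The conditional law of the adjacency matrix given the latent positions \<open>\<omega>\<close>.\<close>

definition adjacency_pmf ::
    "nat \<Rightarrow> ('a \<Rightarrow> 'a \<Rightarrow> real) \<Rightarrow> (nat \<Rightarrow> 'a) \<Rightarrow> (nat \<Rightarrow> nat \<Rightarrow> real) pmf" where
  "adjacency_pmf n W \<omega> =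
     map_pmf adjacency_matrix
       (Pi_pmf (edge_pairs n) False (\<lambda>(i, j). bernoulli_pmf (W (\<omega> i) (\<omega> j))))"

text \<open>The joint law of the latent positions and the adjacency matrix.\<close>

definition W_random_graph ::
    "nat \<Rightarrow> 'a measure \<Rightarrow> ('a \<Rightarrow> 'a \<Rightarrow> real) \<Rightarrow> ((nat \<Rightarrow> 'a) \<times> (nat \<Rightarrow> nat \<Rightarrow> real)) measure" where
  "W_random_graph n M W =
     (\<Pi>\<^sub>M i\<in>{1..n}. M) \<bind>
       (\<lambda>\<omega>. distr (measure_pmf (adjacency_pmf n W \<omega>))
                  ((\<Pi>\<^sub>M i\<in>{1..n}. M) \<Otimes>\<^sub>M count_space UNIV) (\<lambda>A. (\<omega>, A)))"


lemma finite_edge_pairs: "finite (edge_pairs n)"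
  by (rule finite_subset[of _ "{1..n} \<times> {1..n}"]) (auto simp: edge_pairs_def)

context graphon
begin

lemma measurable_adjacency_pmf:
  "(\<lambda>\<omega>. measure_pmf (adjacency_pmf n W \<omega>))
     \<in> measurable (\<Pi>\<^sub>M i\<in>{1..n}. M) (subprob_algebra (count_space UNIV))"
proof (rule measurable_subprob_algebra)
  let ?P = "\<Pi>\<^sub>M i\<in>{1..n}. M"
  fix X :: "(nat \<Rightarrow> nat \<Rightarrow> real) set"
  define S :: "(nat \<times> nat \<Rightarrow> bool) set" where "S = PiE_dflt (edge_pairs n) False (\<lambda>_. UNIV)"
  define Y where "Y = adjacency_matrix -` X \<inter> S"
  have "finite S"
    unfolding S_def by (rule finite_PiE_dflt) (auto simp: finite_edge_pairs)
  then have finY: "finite Y"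
    by (simp add: Y_def)
  have eq: "emeasure (measure_pmf (adjacency_pmf n W \<omega>)) X =
      (\<Sum>e\<in>Y. ennreal (\<Prod>(i, j)\<in>edge_pairs n.
        if e (i, j) then W (\<omega> i) (\<omega> j) else 1 - W (\<omega> i) (\<omega> j)))"
    if "\<omega> \<in> space ?P" for \<omega>
  proof -
    let ?p = "Pi_pmf (edge_pairs n) False (\<lambda>(i, j). bernoulli_pmf (W (\<omega> i) (\<omega> j)))"
    have "set_pmf ?p \<subseteq> S"
      using set_Pi_pmf_subset[OF finite_edge_pairs[of n]] by (force simp: S_def PiE_dflt_def)
    then have "emeasure (measure_pmf ?p) (adjacency_matrix -` X) = emeasure (measure_pmf ?p) Y"
      unfolding Y_def by (intro emeasure_eq_AE) (auto simp: AE_measure_pmf_iff)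
    also have "\<dots> = (\<Sum>e\<in>Y. ennreal (pmf ?p e))"
      using finY by (simp add: emeasure_measure_pmf_finite flip: sum_ennreal)
    also have "\<dots> = (\<Sum>e\<in>Y. ennreal (\<Prod>(i, j)\<in>edge_pairs n.
        if e (i, j) then W (\<omega> i) (\<omega> j) else 1 - W (\<omega> i) (\<omega> j)))"
    proof (intro sum.cong refl arg_cong[where f = ennreal])
      fix e assume "e \<in> Y"
      then have "\<And>x. x \<notin> edge_pairs n \<Longrightarrow> e x = False"
        by (auto simp: Y_def S_def PiE_dflt_def)
      then have "pmf ?p e = (\<Prod>x\<in>edge_pairs n. pmf (case x of (i, j) \<Rightarrow> bernoulli_pmf (W (\<omega> i) (\<omega> j))) (e x))"
        by (rule pmf_Pi'[OF finite_edge_pairs])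
      also have "\<dots> = (\<Prod>(i, j)\<in>edge_pairs n.
          if e (i, j) then W (\<omega> i) (\<omega> j) else 1 - W (\<omega> i) (\<omega> j))"
      proof (rule prod.cong[OF refl])
        fix x assume "x \<in> edge_pairs n"
        then obtain i j where x: "x = (i, j)" "i \<in> {1..n}" "j \<in> {1..n}"
          by (auto simp: edge_pairs_def)
        have "W (\<omega> i) (\<omega> j) \<in> {0..1}"
          using that x by (intro range_W) (auto simp: space_PiM PiE_iff)
        then show "pmf (case x of (i, j) \<Rightarrow> bernoulli_pmf (W (\<omega> i) (\<omega> j))) (e x) =
            (case x of (i, j) \<Rightarrow> if e (i, j) then W (\<omega> i) (\<omega> j) else 1 - W (\<omega> i) (\<omega> j))"
          by (cases "e x") (auto simp: x)
      qed
      finally show "pmf ?p e = (\<Prod>(i, j)\<in>edge_pairs n.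
          if e (i, j) then W (\<omega> i) (\<omega> j) else 1 - W (\<omega> i) (\<omega> j))" .
    qed
    finally show ?thesis
      by (simp add: adjacency_pmf_def)
  qed
  have "(\<lambda>\<omega>. W (\<omega> i) (\<omega> j)) \<in> borel_measurable ?P" if "(i, j) \<in> edge_pairs n" for i j
  proof -
    from that have "i \<in> {1..n}" "j \<in> {1..n}"
      by (auto simp: edge_pairs_def)
    then have "(\<lambda>\<omega>. (\<omega> i, \<omega> j)) \<in> measurable ?P (M \<Otimes>\<^sub>M M)"
      by (intro measurable_Pair measurable_component_singleton)
    from measurable_compose[OF this measurable_W] show ?thesis
      by simp
  qed
  then have "(\<lambda>\<omega>. \<Sum>e\<in>Y. ennreal (\<Prod>(i, j)\<in>edge_pairs n.
      if e (i, j) then W (\<omega> i) (\<omega> j) else 1 - W (\<omega> i) (\<omega> j))) \<in> borel_measurable ?P"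
    by (intro borel_measurable_sum measurable_compose[OF _ measurable_ennreal]
        borel_measurable_prod) (auto intro!: borel_measurable_diff)
  then show "(\<lambda>\<omega>. emeasure (measure_pmf (adjacency_pmf n W \<omega>)) X) \<in> borel_measurable ?P"
    by (subst measurable_cong[OF eq])
qed (auto intro: measure_pmf.subprob_space_axioms)

lemma measurable_W_random_graph_kernel:
  "(\<lambda>\<omega>. distr (measure_pmf (adjacency_pmf n W \<omega>))
       ((\<Pi>\<^sub>M i\<in>{1..n}. M) \<Otimes>\<^sub>M count_space UNIV) (\<lambda>A. (\<omega>, A)))
     \<in> measurable (\<Pi>\<^sub>M i\<in>{1..n}. M)
         (subprob_algebra ((\<Pi>\<^sub>M i\<in>{1..n}. M) \<Otimes>\<^sub>M count_space UNIV))"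
  by (rule measurable_distr2[OF _ measurable_adjacency_pmf]) simp

lemma space_PiM_nonempty: "space (\<Pi>\<^sub>M i\<in>{1..n}. M) \<noteq> {}"
  by (intro prob_space.not_empty prob_space_PiM) (rule prob_space_axioms)

lemma sets_W_random_graph:
  "sets (W_random_graph n M W) = sets ((\<Pi>\<^sub>M i\<in>{1..n}. M) \<Otimes>\<^sub>M count_space UNIV)"
  unfolding W_random_graph_def by (rule sets_bind[OF _ space_PiM_nonempty]) (rule sets_distr)

lemma prob_space_W_random_graph: "prob_space (W_random_graph n M W)"
  unfolding W_random_graph_def
proof (rule prob_space.prob_space_bind[OF _ _ measurable_W_random_graph_kernel])
  show "prob_space (\<Pi>\<^sub>M i\<in>{1..n}. M)"
    by (intro prob_space_PiM) (rule prob_space_axioms)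
  show "AE \<omega> in \<Pi>\<^sub>M i\<in>{1..n}. M. prob_space (distr (measure_pmf (adjacency_pmf n W \<omega>))
       ((\<Pi>\<^sub>M i\<in>{1..n}. M) \<Otimes>\<^sub>M count_space UNIV) (\<lambda>A. (\<omega>, A)))"
    by (intro AE_I2 measure_pmf.prob_space_distr measurable_Pair) auto
qed

lemma emeasure_W_random_graph:
  assumes B: "B \<in> sets (\<Pi>\<^sub>M i\<in>{1..n}. M)"
  shows "emeasure (W_random_graph n M W) (B \<times> X) =
    (\<integral>\<^sup>+\<omega>\<in>B. emeasure (measure_pmf (adjacency_pmf n W \<omega>)) X \<partial>(\<Pi>\<^sub>M i\<in>{1..n}. M))"
proof -
  have "emeasure (W_random_graph n M W) (B \<times> X) =
      (\<integral>\<^sup>+\<omega>. emeasure (distr (measure_pmf (adjacency_pmf n W \<omega>))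
        ((\<Pi>\<^sub>M i\<in>{1..n}. M) \<Otimes>\<^sub>M count_space UNIV) (\<lambda>A. (\<omega>, A))) (B \<times> X) \<partial>(\<Pi>\<^sub>M i\<in>{1..n}. M))"
    unfolding W_random_graph_def using B
    by (intro emeasure_bind[OF space_PiM_nonempty measurable_W_random_graph_kernel]) auto
  also have "\<dots> = (\<integral>\<^sup>+\<omega>\<in>B. emeasure (measure_pmf (adjacency_pmf n W \<omega>)) X \<partial>(\<Pi>\<^sub>M i\<in>{1..n}. M))"
    using B by (intro nn_integral_cong, subst emeasure_distr)
      (auto simp: indicator_def vimage_def space_pair_measure)
  finally show ?thesis .
qed

end


definition row_inner :: "nat \<Rightarrow> (nat \<Rightarrow> real) \<Rightarrow> (nat \<Rightarrow> real) \<Rightarrow> real" where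
  "row_inner n u v = (1 / real n) * (\<Sum>k = 1..n. u k * v k)"

definition f_hat :: "nat \<Rightarrow> (nat \<Rightarrow> nat \<Rightarrow> real) \<Rightarrow> nat \<Rightarrow> nat \<Rightarrow> real" where
  "f_hat n A i j =
     Max ((\<lambda>k. \<bar>row_inner n (A k) (\<lambda>l. A i l - A j l)\<bar>) ` ({1..n} - {i, j}))"

text \<open>
  Both argmins may be attained at several indices. The following predicates describe an arbitrary
  selection of minimizers, \<open>m\<close> for the neighborhood distance and \<open>mh\<close> for its empirical proxy.
\<close>

definition nearest_neighbor ::
    "nat \<Rightarrow> 'a measure \<Rightarrow> ('a \<Rightarrow> 'a \<Rightarrow> real) \<Rightarrow> (nat \<Rightarrow> 'a) \<Rightarrow> (nat \<Rightarrow> nat) \<Rightarrow> bool" where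
  "nearest_neighbor n M W \<omega> m \<longleftrightarrow>
     (\<forall>i\<in>{1..n}. is_arg_min (\<lambda>t. neighborhood_dist M W (\<omega> i) (\<omega> t)) (\<lambda>t. t \<in> {1..n} - {i}) (m i))"

definition empirical_neighbor :: "nat \<Rightarrow> (nat \<Rightarrow> nat \<Rightarrow> real) \<Rightarrow> (nat \<Rightarrow> nat) \<Rightarrow> bool" where
  "empirical_neighbor n A mh \<longleftrightarrow>
     (\<forall>i\<in>{1..n}. is_arg_min (f_hat n A i) (\<lambda>j. j \<in> {1..n} - {i}) (mh i))"

text \<open>
  Only meaningful for \<open>i \<noteq> j\<close>: on the diagonal, \<open>row_inner n (A i) (A i)\<close> is the normalized degree
  of \<open>i\<close> (the entries are 0 or 1) and not an estimate of the squared norm of \<open>W (\<omega> i)\<close>.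
\<close>

definition dist_sq_estimator ::
    "nat \<Rightarrow> (nat \<Rightarrow> nat \<Rightarrow> real) \<Rightarrow> (nat \<Rightarrow> nat) \<Rightarrow> nat \<Rightarrow> nat \<Rightarrow> real" where
  "dist_sq_estimator n A mh i j =
     row_inner n (A i) (A (mh i)) + row_inner n (A j) (A (mh j)) - 2 * row_inner n (A i) (A j)"

end

theory Submission
  imports Defs
begin

text \<open>
  Two applications of Hoeffding's inequality, first to the edges given the latent positions and then
  to the latent positions other than \<open>\<omega> i\<close> and \<open>\<omega> j\<close>, show that with high probability
  \<open>row_inner n (A i) (A j)\<close> is within \<open>\<delta>\<close>, of order \<open>sqrt (ln n / n)\<close>, of the \<open>L\<^sup>2\<close> inner
  product of \<open>W (\<omega> i)\<close> and \<open>W (\<omega> j)\<close>, for all \<open>i \<noteq> j\<close>. On that event the statement is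
  deterministic, and only the squared norm of \<open>W (\<omega> i)\<close> needs an argument. By minimality,
  \<open>f_hat n A i (mh i) \<le> f_hat n A i (m i)\<close>, which is at most the nearest neighbor distance plus
  \<open>2 * \<delta>\<close>. Testing this bound against \<open>W (\<omega> (m i))\<close>, which is close to \<open>W (\<omega> i)\<close>, shows that the
  inner product of \<open>W (\<omega> i)\<close> with \<open>W (\<omega> (mh i))\<close> is close to its squared norm.
\<close>

section \<open>Row inner products, the empirical proxy and selections of minimizers\<close>

lemma row_inner_diff: "row_inner n u (\<lambda>l. v l - w l) = row_inner n u v - row_inner n u w"
  by (simp add: row_inner_def right_diff_distrib sum_subtractf)

lemma f_hat_ge:
  assumes "k \<in> {1..n} - {i, j}"
  shows "\<bar>row_inner n (A k) (A i) - row_inner n (A k) (A j)\<bar> \<le> f_hat n A i j"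
  unfolding f_hat_def using assms by (intro Max_ge) (auto simp: row_inner_diff)

lemma f_hat_le:
  assumes "3 \<le> n"
    and "\<And>k. k \<in> {1..n} - {i, j} \<Longrightarrow> \<bar>row_inner n (A k) (A i) - row_inner n (A k) (A j)\<bar> \<le> c"
  shows "f_hat n A i j \<le> c"
proof -
  \<comment> \<open>Three nodes leave an index besides \<open>i\<close> and \<open>j\<close>, so the
    maximum is over a nonempty set, as \<open>Max_le_iff\<close> requires.\<close>
  have "\<not> {1..n} \<subseteq> {i, j}"
  proof
    assume "{1..n} \<subseteq> {i, j}"
    then have "card {1..n} \<le> card {i, j}"
      by (intro card_mono) auto
    also have "\<dots> \<le> 2"
      by (simp add: card_insert_if)
    finally show False
      using assms(1) by simp
  qed
  then show ?thesis
    unfolding f_hat_def using assms(2)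
    by (subst Max_le_iff) (auto simp: row_inner_diff)
qed

text \<open>Lets \<open>sets_accurate_event\<close> replace an arbitrary selection by one from a
  finite function space: minimality only looks at the values on \<open>{1..n}\<close>.\<close>

lemma nearest_neighbor_restrict:
  "nearest_neighbor n M W \<omega> (restrict m {1..n}) \<longleftrightarrow> nearest_neighbor n M W \<omega> m"
  by (simp add: nearest_neighbor_def)

lemma empirical_neighbor_restrict:
  "empirical_neighbor n A (restrict m {1..n}) \<longleftrightarrow> empirical_neighbor n A m"
  by (simp add: empirical_neighbor_def)

lemma nearest_neighbor_range:
  "nearest_neighbor n M W \<omega> m \<Longrightarrow> i \<in> {1..n} \<Longrightarrow> m i \<in> {1..n}"
  by (auto simp: nearest_neighbor_def is_arg_min_def)

lemma empirical_neighbor_range: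
  "empirical_neighbor n A m \<Longrightarrow> i \<in> {1..n} \<Longrightarrow> m i \<in> {1..n}"
  by (auto simp: empirical_neighbor_def is_arg_min_def)

section \<open>Hoeffding's inequality, union bound and independent blocks\<close>

lemma (in prob_space) Hoeffding_unit_interval:
  fixes X :: "'i \<Rightarrow> 'a \<Rightarrow> real"
  assumes "finite I" "I \<noteq> {}" "indep_vars (\<lambda>_. borel) X I"
    and "\<And>i x. i \<in> I \<Longrightarrow> x \<in> space M \<Longrightarrow> X i x \<in> {0..1}" and "0 \<le> \<epsilon>"
  shows "prob {x \<in> space M. \<epsilon> \<le> \<bar>(\<Sum>i\<in>I. X i x) - (\<Sum>i\<in>I. expectation (X i))\<bar>}
    \<le> 2 * exp (- 2 * \<epsilon>\<^sup>2 / real (card I))"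
proof -
  interpret Hoeffding_ineq M I X "\<lambda>_. 0" "\<lambda>_. 1" "\<Sum>i\<in>I. expectation (X i)"
    using assms by unfold_locales auto
  show ?thesis
    using Hoeffding_ineq_abs_ge[of \<epsilon>] assms by (simp add: card_gt_0_iff)
qed

text \<open>The map collecting the coordinates is the identity on the product space, so their joint
  law is the product measure, which is also the product of their marginals; this factorization
  characterizes independence.\<close>

lemma indep_vars_PiM_coordinate:
  assumes "finite I" "I \<noteq> {}" "\<And>i. i \<in> I \<Longrightarrow> prob_space (M i)"
  shows "prob_space.indep_vars (\<Pi>\<^sub>M i\<in>I. M i) M (\<lambda>i \<omega>. \<omega> i) I"
proof -
  interpret prob_space "\<Pi>\<^sub>M i\<in>I. M i"
    using assms by (intro prob_space_PiM) auto
  have "distr (Pi\<^sub>M I M) (\<Pi>\<^sub>M i\<in>I. M i) (\<lambda>\<omega>. \<lambda>i\<in>I. \<omega> i) = distr (Pi\<^sub>M I M) (Pi\<^sub>M I M) (\<lambda>\<omega>. \<omega>)"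
    by (intro distr_cong) (auto simp: space_PiM)
  also have "\<dots> = (\<Pi>\<^sub>M i\<in>I. distr (Pi\<^sub>M I M) (M i) (\<lambda>\<omega>. \<omega> i))"
    using assms by (auto simp: distr_PiM_component intro!: PiM_cong)
  finally show ?thesis
    using assms by (subst indep_vars_iff_distr_eq_PiM') auto
qed

lemma card_atLeastAtMost_Diff_pair:
  "i \<in> {1..n} \<Longrightarrow> j \<in> {1..n} \<Longrightarrow> i \<noteq> j \<Longrightarrow> card ({1..n} - {i, j}) = n - 2"
  for i j n :: nat
  by (subst card_Diff_subset) auto

text \<open>The threshold is chosen to give this tail: a union bound over at most
  \<open>n * n\<close> pairs still leaves a multiple of \<open>1 / n ^ 2\<close>.\<close>

lemma Hoeffding_constant:
  assumes "1 < n"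
  shows "2 * exp (- 2 * (sqrt (2 * real n * ln (real n)))\<^sup>2 / real n) = 2 / real n ^ 4"
proof -
  have "2 * (sqrt (2 * real n * ln (real n)))\<^sup>2 / real n = 4 * ln (real n)"
    using assms by (simp add: field_simps)
  also have "\<dots> = ln (real n ^ 4)"
    using assms by (simp add: ln_realpow)
  finally show ?thesis
    using assms by (simp add: exp_minus field_simps)
qed

lemma (in prob_space) Hoeffding_sqrt_log:
  fixes X :: "'i \<Rightarrow> 'a \<Rightarrow> real"
  assumes "I \<noteq> {}" "finite I" "card I \<le> n" "1 < n" "indep_vars (\<lambda>_. borel) X I"
    and "\<And>i x. i \<in> I \<Longrightarrow> x \<in> space M \<Longrightarrow> X i x \<in> {0..1}"
  shows "prob {x \<in> space M. sqrt (2 * real n * ln (real n)) \<le>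
      \<bar>(\<Sum>i\<in>I. X i x) - (\<Sum>i\<in>I. expectation (X i))\<bar>} \<le> 2 / real n ^ 4"
proof -
  let ?\<epsilon> = "sqrt (2 * real n * ln (real n))"
  have "prob {x \<in> space M. ?\<epsilon> \<le> \<bar>(\<Sum>i\<in>I. X i x) - (\<Sum>i\<in>I. expectation (X i))\<bar>}
      \<le> 2 * exp (- 2 * ?\<epsilon>\<^sup>2 / real (card I))"
    using assms by (intro Hoeffding_unit_interval) auto
  also have "\<dots> \<le> 2 * exp (- 2 * ?\<epsilon>\<^sup>2 / real n)"
  \<comment> \<open>The exponent improves as the number of summands shrinks, so \<open>n\<close> may
    replace \<open>card I\<close>; nonemptiness keeps the denominator positive.\<close>
  proof -
    have "0 < card I"
      using assms by (simp add: card_gt_0_iff)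
    then have "2 * ?\<epsilon>\<^sup>2 / real n \<le> 2 * ?\<epsilon>\<^sup>2 / real (card I)"
      using assms(3,4) by (intro divide_left_mono) auto
    then show ?thesis
      by simp
  qed
  also have "\<dots> = 2 / real n ^ 4"
    using assms(4) by (rule Hoeffding_constant)
  finally show ?thesis .
qed

lemma (in prob_space) prob_Ex_pair_le:
  assumes "\<And>i j. i \<in> {1..n} \<Longrightarrow> j \<in> {1..n} \<Longrightarrow> i \<noteq> j \<Longrightarrow>
      {x \<in> space M. Q i j x} \<in> events \<and> prob {x \<in> space M. Q i j x} \<le> c / real n ^ 4"
    and "0 \<le> c"
  shows "prob {x \<in> space M. \<exists>i\<in>{1..n}. \<exists>j\<in>{1..n}. i \<noteq> j \<and> Q i j x} \<le> c / real n ^ 2"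
proof -
  let ?S = "{(i, j). i \<in> {1..n} \<and> j \<in> {1..n} \<and> i \<noteq> j}"
  have S: "?S \<subseteq> {1..n} \<times> {1..n}"
    by auto
  have fin: "finite ?S"
    using S by (rule finite_subset) auto
  have card: "card ?S \<le> n * n"
    using card_mono[OF _ S] by simp
  have "prob {x \<in> space M. \<exists>i\<in>{1..n}. \<exists>j\<in>{1..n}. i \<noteq> j \<and> Q i j x} =
      prob (\<Union>p\<in>?S. {x \<in> space M. Q (fst p) (snd p) x})"
    by (intro arg_cong[where f = prob])
       (auto simp del: atLeastAtMost_iff One_nat_def, blast)
  also have "\<dots> \<le> (\<Sum>p\<in>?S. prob {x \<in> space M. Q (fst p) (snd p) x})"
    using assms(1) by (intro finite_measure_subadditive_finite fin) auto
  also have "\<dots> \<le> real (card ?S) * (c / real n ^ 4)"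
    using assms(1) by (intro sum_bounded_above) auto
  also have "\<dots> \<le> real (n * n) * (c / real n ^ 4)"
    using assms(2) by (intro mult_right_mono of_nat_mono card) simp
  also have "\<dots> = c / real n ^ 2"
    \<comment> \<open>For \<open>n = 0\<close> both sides vanish because division by zero yields
      zero.\<close>
    by (cases "n = 0") (auto simp: field_simps eval_nat_numeral)
  finally show ?thesis .
qed

lemma indep_vars_restrict_Pi_pmf:
  assumes "finite I" "\<And>k. k \<in> L \<Longrightarrow> K k \<subseteq> I" "disjoint_family_on K L"
  shows "prob_space.indep_vars (measure_pmf (Pi_pmf I d p)) (\<lambda>k. \<Pi>\<^sub>M x\<in>K k. count_space UNIV)
    (\<lambda>k f. restrict f (K k)) L"
  using prob_space.indep_vars_restrict[OF prob_space_measure_pmf indep_vars_Pi_pmf[OF assms(1)] assms(2,3)] by simp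

text \<open>Meant for common neighbors: the block of \<open>k\<close> will hold the edges from
  \<open>k\<close> to \<open>i\<close> and to \<open>j\<close>. The last assumption says that
  \<open>g k\<close> reads its own block only, so independence passes from the restrictions to
  \<open>g\<close>.\<close>

lemma indep_vars_blocks_Pi_pmf:
  assumes "finite I" "\<And>k. k \<in> L \<Longrightarrow> K k \<subseteq> I" "disjoint_family_on K L"
    and "\<And>k. k \<in> L \<Longrightarrow> g k \<in> measurable (\<Pi>\<^sub>M x\<in>K k. count_space UNIV) N"
    and "\<And>k f. k \<in> L \<Longrightarrow> g k (restrict f (K k)) = g k f"
  shows "prob_space.indep_vars (measure_pmf (Pi_pmf I d p)) (\<lambda>_. N) g L"
proof -
  have "prob_space.indep_vars (measure_pmf (Pi_pmf I d p)) (\<lambda>_. N) (\<lambda>k f. g k (restrict f (K k))) L"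
    by (rule prob_space.indep_vars_compose2[OF prob_space_measure_pmf indep_vars_restrict_Pi_pmf[OF assms(1-3)] assms(4)])
  then show ?thesis
    using assms(5) by (subst (asm) prob_space.indep_vars_cong[OF prob_space_measure_pmf refl _ refl, where Y = g]) (auto simp: fun_eq_iff)
qed

section \<open>Inner products of sections of \<open>W\<close> and the neighborhood distance\<close>

context graphon
begin

definition W_inner :: "'a \<Rightarrow> 'a \<Rightarrow> real" where
  "W_inner x y = (\<integral>z. W x z * W y z \<partial>M)"

lemma measurable_W_compose [measurable (raw)]:
  assumes "f \<in> measurable N M" "g \<in> measurable N M"
  shows "(\<lambda>w. W (f w) (g w)) \<in> borel_measurable N"
  using measurable_compose[OF measurable_Pair[OF assms] measurable_W] by simp

lemma W_bounds: "x \<in> space M \<Longrightarrow> y \<in> space M \<Longrightarrow> 0 \<le> W x y \<and> W x y \<le> 1"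
  using range_W by simp

lemma integrable_unit_interval:
  fixes f :: "'a \<Rightarrow> real"
  assumes "f \<in> borel_measurable M" "\<And>z. z \<in> space M \<Longrightarrow> \<bar>f z\<bar> \<le> 1"
  shows "integrable M f"
  using assms by (intro integrable_const_bound[where B = 1]) auto

lemma abs_W_mult_le_one:
  "x \<in> space M \<Longrightarrow> y \<in> space M \<Longrightarrow> z \<in> space M \<Longrightarrow> \<bar>W x z * W y z\<bar> \<le> 1"
  using W_bounds[of x z] W_bounds[of y z] by (simp add: abs_mult mult_le_one)

lemma abs_W_diff_le_one:
  "x \<in> space M \<Longrightarrow> y \<in> space M \<Longrightarrow> z \<in> space M \<Longrightarrow> \<bar>W x z - W y z\<bar> \<le> 1"
  using W_bounds[of x z] W_bounds[of y z] by auto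

lemma integrable_W_mult: "x \<in> space M \<Longrightarrow> y \<in> space M \<Longrightarrow> integrable M (\<lambda>z. W x z * W y z)"
  by (rule integrable_unit_interval) (auto intro: abs_W_mult_le_one)

lemma W_inner_bounds: "x \<in> space M \<Longrightarrow> y \<in> space M \<Longrightarrow> 0 \<le> W_inner x y \<and> W_inner x y \<le> 1"
  unfolding W_inner_def using W_bounds
  by (intro conjI integral_nonneg_AE integral_le_const AE_I2 integrable_W_mult)
     (auto intro: mult_le_one)

lemma neighborhood_dist_nonneg: "0 \<le> neighborhood_dist M W x y"
  by (simp add: neighborhood_dist_def)

text \<open>Polarization splits the target into a cross term, which a pair of rows estimates
  directly, and two squared norms, for which a neighbor's row has to stand in.\<close>

lemma neighborhood_dist_sq:
  assumes "x \<in> space M" "y \<in> space M"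
  shows "(neighborhood_dist M W x y)\<^sup>2 = W_inner x x + W_inner y y - 2 * W_inner x y"
proof -
  have "(neighborhood_dist M W x y)\<^sup>2 = (\<integral>z. \<bar>W x z - W y z\<bar>\<^sup>2 \<partial>M)"
    by (simp add: neighborhood_dist_def)
  also have "\<dots> = (\<integral>z. W x z * W x z + W y z * W y z - 2 * (W x z * W y z) \<partial>M)"
    by (simp add: power2_eq_square algebra_simps)
  also have "\<dots> = W_inner x x + W_inner y y - 2 * W_inner x y"
    unfolding W_inner_def using assms by (simp add: integrable_W_mult)
  finally show ?thesis .
qed

text \<open>The variance of \<open>\<bar>W x - W y\<bar>\<close> is nonnegative, so its \<open>L\<^sup>1\<close> norm is at most its \<open>L\<^sup>2\<close> norm.\<close>

lemma abs_integral_mult_W_diff_le: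
  fixes g :: "'a \<Rightarrow> real"
  assumes x: "x \<in> space M" and y: "y \<in> space M"
    and g [measurable]: "g \<in> borel_measurable M" and g1: "\<And>z. z \<in> space M \<Longrightarrow> \<bar>g z\<bar> \<le> 1"
  shows "\<bar>\<integral>z. g z * (W x z - W y z) \<partial>M\<bar> \<le> neighborhood_dist M W x y"
proof -
  let ?d = "\<lambda>z. \<bar>W x z - W y z\<bar>"
  have [measurable]: "?d \<in> borel_measurable M"
    using x y by measurable
  have d: "?d z \<le> 1" if "z \<in> space M" for z
    using abs_W_diff_le_one x y that .
  have id: "integrable M ?d"
    by (rule integrable_unit_interval) (auto intro: d)
  have id2: "integrable M (\<lambda>z. (?d z)\<^sup>2)"
    by (rule integrable_unit_interval) (measurable, simp add: abs_square_le_1 d)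
  have "\<bar>\<integral>z. g z * (W x z - W y z) \<partial>M\<bar> \<le> (\<integral>z. \<bar>g z * (W x z - W y z)\<bar> \<partial>M)"
    by (rule integral_abs_bound)
  also have "\<dots> \<le> (\<integral>z. ?d z \<partial>M)"
  proof (rule integral_mono)
    show "integrable M (\<lambda>z. \<bar>g z * (W x z - W y z)\<bar>)"
      using x y by (intro integrable_unit_interval) (auto simp: abs_mult intro!: mult_le_one g1 d)
  qed (auto simp: id abs_mult intro!: mult_left_le_one_le g1)
  also have "\<dots> \<le> neighborhood_dist M W x y"
    unfolding neighborhood_dist_def
    using variance_positive[of ?d] variance_eq[OF id id2]
    by (intro real_le_rsqrt) simp
  finally show ?thesis .
qed

lemma W_inner_diff:
  assumes "x \<in> space M" "y \<in> space M" "z \<in> space M"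
  shows "W_inner z x - W_inner z y = (\<integral>v. W z v * (W x v - W y v) \<partial>M)"
  using assms by (simp add: W_inner_def integrable_W_mult right_diff_distrib)

text \<open>The section \<open>W z\<close> is bounded by one, hence an admissible test function in
  \<open>abs_integral_mult_W_diff_le\<close>.\<close>

lemma abs_W_inner_diff_le:
  assumes "x \<in> space M" "y \<in> space M" "z \<in> space M"
  shows "\<bar>W_inner z x - W_inner z y\<bar> \<le> neighborhood_dist M W x y"
  unfolding W_inner_diff[OF assms] using assms W_bounds[OF assms(3)]
  by (intro abs_integral_mult_W_diff_le) auto

section \<open>Deterministic error bounds when all row inner products are accurate\<close>

context
  fixes n :: nat and \<omega> :: "nat \<Rightarrow> 'a" and A :: "nat \<Rightarrow> nat \<Rightarrow> real" and \<delta> :: real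
  assumes n: "3 \<le> n" and \<omega>: "\<And>i. i \<in> {1..n} \<Longrightarrow> \<omega> i \<in> space M"
    and close: "\<And>i j. i \<in> {1..n} \<Longrightarrow> j \<in> {1..n} \<Longrightarrow> i \<noteq> j \<Longrightarrow>
      \<bar>row_inner n (A i) (A j) - W_inner (\<omega> i) (\<omega> j)\<bar> \<le> \<delta>"
begin

text \<open>Each of the two row inner products is traded for \<open>W_inner\<close> at cost
  \<open>\<delta>\<close>; the maximum runs over \<open>k\<close> distinct from \<open>i\<close> and
  \<open>j\<close>, so \<open>close\<close> covers both.\<close>

lemma f_hat_le_neighborhood_dist:
  assumes "i \<in> {1..n}" "j \<in> {1..n}"
  shows "f_hat n A i j \<le> neighborhood_dist M W (\<omega> i) (\<omega> j) + 2 * \<delta>"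
proof (rule f_hat_le[OF n])
  fix k assume "k \<in> {1..n} - {i, j}"
  then show "\<bar>row_inner n (A k) (A i) - row_inner n (A k) (A j)\<bar>
      \<le> neighborhood_dist M W (\<omega> i) (\<omega> j) + 2 * \<delta>"
    using close[of k i] close[of k j] assms
      abs_W_inner_diff_le[OF \<omega> \<omega> \<omega>, of i j k] by auto
qed

text \<open>
  The inner product with \<open>W (\<omega> i)\<close> is not controlled by \<open>f_hat\<close>, since \<open>i\<close> is excluded from the
  maximum; replacing it by \<open>W (\<omega> (m i))\<close> costs only the distance to the nearest neighbor.
\<close>

lemma norm_estimate:
  assumes i: "i \<in> {1..n}" and m: "m \<in> {1..n} - {i}"
    and h: "is_arg_min (f_hat n A i) (\<lambda>j. j \<in> {1..n} - {i}) h"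
  shows "\<bar>row_inner n (A i) (A h) - W_inner (\<omega> i) (\<omega> i)\<bar>
    \<le> 2 * neighborhood_dist M W (\<omega> i) (\<omega> m) + 5 * \<delta>"
proof -
  let ?r = "neighborhood_dist M W (\<omega> i) (\<omega> m)"
  have h': "h \<in> {1..n} - {i}" and hmin: "f_hat n A i h \<le> f_hat n A i m"
    using h m by (auto simp: is_arg_min_linorder)
  have \<delta>: "0 \<le> \<delta>"
    using close[OF i, of m] m by auto
  have "\<bar>W_inner (\<omega> i) (\<omega> i) - W_inner (\<omega> i) (\<omega> h)\<bar> \<le> 2 * ?r + 4 * \<delta>"
  \<comment> \<open>\<open>f_hat n A i h\<close> excludes \<open>k = h\<close>, so it offers no test
    against row \<open>m\<close> when \<open>h = m\<close>; in that case
    \<open>W (\<omega> h)\<close> is itself the nearby section.\<close>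
  proof (cases "h = m")
    case True
    then show ?thesis
      using abs_W_inner_diff_le[OF \<omega> \<omega> \<omega>, of i m i] i m \<delta> neighborhood_dist_nonneg[of "\<omega> i" "\<omega> m"]
      by auto
  next
    case False
    have sp: "\<omega> i \<in> space M" "\<omega> m \<in> space M" "\<omega> h \<in> space M"
      using \<omega> i m h' by auto
    \<comment> \<open>Pairing the bounded function \<open>W (\<omega> i) - W (\<omega> h)\<close>
      with \<open>W (\<omega> i) - W (\<omega> m)\<close> measures the cost of exchanging
      \<open>W (\<omega> i)\<close> for \<open>W (\<omega> m)\<close> as the test section.\<close>
    have "\<bar>\<integral>z. (W (\<omega> i) z - W (\<omega> h) z) * (W (\<omega> i) z - W (\<omega> m) z) \<partial>M\<bar> \<le> ?r"
      using sp by (intro abs_integral_mult_W_diff_le) (auto intro: abs_W_diff_le_one)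
    also have "(\<integral>z. (W (\<omega> i) z - W (\<omega> h) z) * (W (\<omega> i) z - W (\<omega> m) z) \<partial>M) =
        (\<integral>z. W (\<omega> i) z * (W (\<omega> i) z - W (\<omega> h) z) - W (\<omega> m) z * (W (\<omega> i) z - W (\<omega> h) z) \<partial>M)"
      by (simp add: algebra_simps)
    also have "\<dots> = (W_inner (\<omega> i) (\<omega> i) - W_inner (\<omega> i) (\<omega> h)) - (W_inner (\<omega> m) (\<omega> i) - W_inner (\<omega> m) (\<omega> h))"
      using sp by (simp add: W_inner_diff integrable_W_mult right_diff_distrib)
    finally have 1: "\<bar>(W_inner (\<omega> i) (\<omega> i) - W_inner (\<omega> i) (\<omega> h)) -
        (W_inner (\<omega> m) (\<omega> i) - W_inner (\<omega> m) (\<omega> h))\<bar> \<le> ?r" .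
    \<comment> \<open>Here \<open>m\<close> differs from both \<open>i\<close> and \<open>h\<close>,
      so it is among the indices of the maximum.\<close>
    have "\<bar>row_inner n (A m) (A i) - row_inner n (A m) (A h)\<bar> \<le> f_hat n A i h"
      using m False by (intro f_hat_ge) auto
    also have "\<dots> \<le> ?r + 2 * \<delta>"
      using hmin f_hat_le_neighborhood_dist[of i m] i m by auto
    \<comment> \<open>The contributions are \<open>?r\<close> for the exchange,
      \<open>?r + 2 * \<delta>\<close> for the proxy and \<open>2 * \<delta>\<close> for passing
      from rows to \<open>W_inner\<close>.\<close>
    finally show ?thesis
      using 1 close[of m i] close[of m h] m i h' False by auto
  qed
  then show ?thesis
    using close[of i h] i h' by auto
qed

text \<open>Each squared norm contributes \<open>5 * \<delta>\<close> and the doubled cross term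
  \<open>2 * \<delta>\<close>, hence the factor \<open>12\<close>; \<open>close\<close> reaches the
  cross term because \<open>i\<close> and \<open>j\<close> differ.\<close>

lemma dist_sq_estimator_error:
  assumes "nearest_neighbor n M W \<omega> m" "empirical_neighbor n A mh"
    and ij: "i \<in> {1..n}" "j \<in> {1..n}" "i \<noteq> j"
  shows "\<bar>(neighborhood_dist M W (\<omega> i) (\<omega> j))\<^sup>2 - dist_sq_estimator n A mh i j\<bar> \<le>
    2 * neighborhood_dist M W (\<omega> j) (\<omega> (m j)) + 2 * neighborhood_dist M W (\<omega> i) (\<omega> (m i)) + 12 * \<delta>"
proof -
  have "\<bar>row_inner n (A k) (A (mh k)) - W_inner (\<omega> k) (\<omega> k)\<bar>
      \<le> 2 * neighborhood_dist M W (\<omega> k) (\<omega> (m k)) + 5 * \<delta>" if "k \<in> {1..n}" for k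
    using assms(1,2) that
    by (intro norm_estimate) (auto simp: nearest_neighbor_def empirical_neighbor_def is_arg_min_def)
  from this[of i] this[of j] close[of i j] ij show ?thesis
    unfolding neighborhood_dist_sq[OF \<omega>[OF ij(1)] \<omega>[OF ij(2)]] dist_sq_estimator_def
    by (auto simp: abs_le_iff)
qed

end

section \<open>Concentration over the latent positions, then over the edges\<close>

lemma latent_deviation_pair:
  assumes n: "3 \<le> n" and ij: "i \<in> {1..n}" "j \<in> {1..n}" "i \<noteq> j"
  defines "Q \<equiv> \<lambda>\<omega>. sqrt (2 * real n * ln (real n)) \<le>
    \<bar>(\<Sum>k\<in>{1..n} - {i, j}. W (\<omega> i) (\<omega> k) * W (\<omega> j) (\<omega> k)) - real (n - 2) * W_inner (\<omega> i) (\<omega> j)\<bar>"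
  shows "{\<omega> \<in> space (\<Pi>\<^sub>M i\<in>{1..n}. M). Q \<omega>} \<in> sets (\<Pi>\<^sub>M i\<in>{1..n}. M) \<and>
    measure (\<Pi>\<^sub>M i\<in>{1..n}. M) {\<omega> \<in> space (\<Pi>\<^sub>M i\<in>{1..n}. M). Q \<omega>} \<le> 2 / real n ^ 4"
proof
  let ?K = "{1..n} - {i, j}"
  let ?P = "\<Pi>\<^sub>M i\<in>{1..n}. M"
  let ?B = "{\<omega> \<in> space ?P. Q \<omega>}"
  have K: "?K \<noteq> {}" "card ?K = n - 2" "{i, j} \<union> ?K = {1..n}" "{i, j} \<inter> ?K = {}"
  proof -
    show "card ?K = n - 2"
      by (rule card_atLeastAtMost_Diff_pair[OF ij])
    with n show "?K \<noteq> {}"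
      by (intro notI) (simp only: card.empty)
  qed (use ij in auto)
  show B: "?B \<in> sets ?P"
    unfolding Q_def W_inner_def using ij by measurable
  interpret P: prob_space ?P
    by (intro prob_space_PiM) (rule prob_space_axioms)
  interpret K: prob_space "\<Pi>\<^sub>M i\<in>?K. M"
    by (intro prob_space_PiM) (rule prob_space_axioms)
  interpret IJ: prob_space "\<Pi>\<^sub>M i\<in>{i, j}. M"
    by (intro prob_space_PiM) (rule prob_space_axioms)
  interpret S: product_sigma_finite "\<lambda>_. M" ..
  have inner: "(\<integral>\<^sup>+y. indicator ?B (merge {i, j} ?K (x, y)) \<partial>(\<Pi>\<^sub>M i\<in>?K. M)) \<le> ennreal (2 / real n ^ 4)"
    if x: "x \<in> space (\<Pi>\<^sub>M i\<in>{i, j}. M)" for x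
  proof -
    let ?X = "\<lambda>k (y :: nat \<Rightarrow> 'a). W (x i) (y k) * W (x j) (y k)"
    have xij [measurable]: "x i \<in> space M" "x j \<in> space M"
      using x by (auto simp: space_PiM PiE_iff)
    have meas: "(\<lambda>z. W (x i) z * W (x j) z) \<in> borel_measurable M"
      by measurable
    have E: "K.expectation (?X k) = W_inner (x i) (x j)" if "k \<in> ?K" for k
    proof -
      have "W_inner (x i) (x j) = (\<integral>z. W (x i) z * W (x j) z \<partial>distr (\<Pi>\<^sub>M i\<in>?K. M) M (\<lambda>y. y k))"
        unfolding W_inner_def
        using distr_PiM_component[of ?K "\<lambda>_. M" k] that prob_space_axioms by simp
      also have "\<dots> = K.expectation (?X k)"
        using that by (intro integral_distr meas) auto
      finally show ?thesis ..
    qed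
    have sumE: "(\<Sum>k\<in>?K. K.expectation (?X k)) = real (n - 2) * W_inner (x i) (x j)"
      unfolding K(2)[symmetric] by (subst sum.cong[OF refl E]) auto
    \<comment> \<open>In the merged family \<open>i\<close> and \<open>j\<close> read
      \<open>x\<close> and every \<open>k\<close> in \<open>?K\<close> reads \<open>y\<close>, so
      the section of the event at \<open>x\<close> is a Hoeffding event in \<open>y\<close>
      alone.\<close>
    have *: "indicator ?B (merge {i, j} ?K (x, y)) = (indicator {y \<in> space (\<Pi>\<^sub>M i\<in>?K. M).
        sqrt (2 * real n * ln (real n)) \<le> \<bar>(\<Sum>k\<in>?K. ?X k y) - (\<Sum>k\<in>?K. K.expectation (?X k))\<bar>} y :: ennreal)"
      if y: "y \<in> space (\<Pi>\<^sub>M i\<in>?K. M)" for y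
    proof -
      have "merge {i, j} ?K (x, y) \<in> space ?P"
        using measurable_space[OF measurable_merge[of "{i, j}" ?K "\<lambda>_. M"], of "(x, y)"] x y K(3)
        by (simp add: space_pair_measure)
      moreover have "(\<Sum>k\<in>?K. W (merge {i, j} ?K (x, y) i) (merge {i, j} ?K (x, y) k) *
          W (merge {i, j} ?K (x, y) j) (merge {i, j} ?K (x, y) k)) = (\<Sum>k\<in>?K. ?X k y)"
        by (intro sum.cong) (auto simp: merge_def)
      moreover have "merge {i, j} ?K (x, y) i = x i" "merge {i, j} ?K (x, y) j = x j"
        by (auto simp: merge_def)
      ultimately show ?thesis
        using y unfolding sumE by (simp add: Q_def indicator_def)
    qed
    have "(\<integral>\<^sup>+y. indicator ?B (merge {i, j} ?K (x, y)) \<partial>(\<Pi>\<^sub>M i\<in>?K. M)) =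
        emeasure (\<Pi>\<^sub>M i\<in>?K. M) {y \<in> space (\<Pi>\<^sub>M i\<in>?K. M). sqrt (2 * real n * ln (real n)) \<le>
          \<bar>(\<Sum>k\<in>?K. ?X k y) - (\<Sum>k\<in>?K. K.expectation (?X k))\<bar>}"
      by (subst nn_integral_indicator[symmetric], measurable) (intro nn_integral_cong *)
    also have "\<dots> \<le> ennreal (2 / real n ^ 4)"
    proof -
      have "K.indep_vars (\<lambda>_. borel) ?X ?K"
        using K(1) prob_space_axioms meas
        by (intro K.indep_vars_compose2[where Y = "\<lambda>_ z. W (x i) z * W (x j) z" and M' = "\<lambda>_. M"]
            indep_vars_PiM_coordinate) auto
      moreover have "?X k y \<in> {0..1}" if "k \<in> ?K" "y \<in> space (\<Pi>\<^sub>M i\<in>?K. M)" for k y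
      proof -
        have "y k \<in> space M"
          using that by (auto simp: space_PiM PiE_iff)
        then show ?thesis
          using W_bounds[OF xij(1)] W_bounds[OF xij(2)] by (auto intro: mult_le_one)
      qed
      ultimately show ?thesis
        unfolding K.emeasure_eq_measure using K n
        by (intro ennreal_leI K.Hoeffding_sqrt_log) auto
    qed
    finally show ?thesis .
  qed
  have "emeasure ?P ?B = (\<integral>\<^sup>+\<omega>. indicator ?B \<omega> \<partial>(\<Pi>\<^sub>M i\<in>{i, j} \<union> ?K. M))"
    using B K(3) by simp
  also have "\<dots> = (\<integral>\<^sup>+x. (\<integral>\<^sup>+y. indicator ?B (merge {i, j} ?K (x, y)) \<partial>(\<Pi>\<^sub>M i\<in>?K. M)) \<partial>(\<Pi>\<^sub>M i\<in>{i, j}. M))"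
    using B K by (intro S.product_nn_integral_fold) auto
  also have "\<dots> \<le> (\<integral>\<^sup>+x. ennreal (2 / real n ^ 4) \<partial>(\<Pi>\<^sub>M i\<in>{i, j}. M))"
    by (intro nn_integral_mono inner)
  also have "\<dots> = ennreal (2 / real n ^ 4)"
    by (simp add: IJ.emeasure_space_1)
  finally show "measure ?P ?B \<le> 2 / real n ^ 4"
    by (simp add: P.emeasure_eq_measure del: One_nat_def)
qed

text \<open>The summand of \<open>k\<close> reads only the edges joining \<open>k\<close> to
  \<open>i\<close> and to \<open>j\<close>. For distinct \<open>k\<close> outside
  \<open>{i, j}\<close> these blocks are disjoint, which gives independence; within a block the two
  edges are distinct, so the mean factorizes.\<close>

lemma conditional_deviation_pair:
  assumes n: "3 \<le> n" and \<omega>: "\<omega> \<in> space (\<Pi>\<^sub>M i\<in>{1..n}. M)"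
    and ij: "i \<in> {1..n}" "j \<in> {1..n}" "i \<noteq> j"
  shows "measure_pmf.prob (adjacency_pmf n W \<omega>) {A. sqrt (2 * real n * ln (real n)) \<le>
    \<bar>real n * row_inner n (A i) (A j) - (\<Sum>k\<in>{1..n} - {i, j}. W (\<omega> i) (\<omega> k) * W (\<omega> j) (\<omega> k))\<bar>}
    \<le> 2 / real n ^ 4"
proof -
  let ?K = "{1..n} - {i, j}"
  let ?E = "edge_pairs n"
  define p where "p = (\<lambda>(a, b). bernoulli_pmf (W (\<omega> a) (\<omega> b)))"
  \<comment> \<open>Edges are keyed by increasing pairs; \<open>e a b\<close> is the key of the
    unordered pair.\<close>
  define e :: "nat \<Rightarrow> nat \<Rightarrow> nat \<times> nat" where "e a b = (min a b, max a b)" for a b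
  let ?p = "Pi_pmf ?E False p"
  define X :: "nat \<Rightarrow> (nat \<times> nat \<Rightarrow> bool) \<Rightarrow> real"
    where "X k f = of_bool (f (e i k)) * of_bool (f (e j k))" for k f
  have \<omega>M: "\<omega> k \<in> space M" if "k \<in> {1..n}" for k
    using \<omega> that by (auto simp: space_PiM PiE_iff)
  have K: "?K \<noteq> {}" "card ?K \<le> n"
  proof -
    have card: "card ?K = n - 2"
      by (rule card_atLeastAtMost_Diff_pair[OF ij])
    then show "card ?K \<le> n"
      by simp
    from card n show "?K \<noteq> {}"
      by (intro notI) (simp only: card.empty)
  qed
  have e_eq: "e a b = e c d \<longleftrightarrow> a = c \<and> b = d \<or> a = d \<and> b = c" for a b c d
    by (simp add: e_def min_def max_def) linarith
  have e: "e i k \<in> ?E" "e j k \<in> ?E" "e i k \<noteq> e j k" if "k \<in> ?K" for k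
    using that ij(1,2) by (auto simp: e_def edge_pairs_def min_def max_def) (use that ij(3) in \<open>auto simp: e_eq\<close>)
  have disj: "disjoint_family_on (\<lambda>k. {e i k, e j k}) ?K"
    by (auto simp: disjoint_family_on_def e_eq)
  have indep: "prob_space.indep_vars ?p (\<lambda>_. borel) X ?K"
  proof (rule indep_vars_blocks_Pi_pmf[OF finite_edge_pairs _ disj])
    fix k
    have "(\<lambda>g. of_bool (g x) :: real) \<in> borel_measurable (\<Pi>\<^sub>M x\<in>{e i k, e j k}. count_space UNIV)"
      if "x \<in> {e i k, e j k}" for x
      by (rule measurable_compose[OF measurable_component_singleton[OF that]]) simp
    then show "X k \<in> borel_measurable (\<Pi>\<^sub>M x\<in>{e i k, e j k}. count_space UNIV)"
      unfolding X_def by (intro borel_measurable_times) auto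
  qed (use e(1,2) in \<open>auto simp: X_def\<close>)
  \<comment> \<open>Sorting may swap the arguments of \<open>W\<close>, which \<open>sym_W\<close>
    undoes.\<close>
  have W: "measure_pmf.expectation (p (e a k)) (\<lambda>v. of_bool v) = W (\<omega> a) (\<omega> k)"
    if "a \<in> {1..n}" "k \<in> {1..n}" for a k
    using W_bounds[OF \<omega>M \<omega>M, OF that] sym_W[OF \<omega>M \<omega>M, OF that]
    by (auto simp: p_def e_def min_def max_def)
  have E: "measure_pmf.expectation ?p (X k) = W (\<omega> i) (\<omega> k) * W (\<omega> j) (\<omega> k)" if k: "k \<in> ?K" for k
  proof -
    let ?S = "{e i k, e j k}"
    have S: "?E \<inter> ?S = ?S"
      using e[OF k] by auto
    \<comment> \<open>Written as a product over all edges, with factor one off the block, the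
      summand fits the factorization of expectations under \<open>Pi_pmf\<close>.\<close>
    have X_eq: "X k f = (\<Prod>x\<in>?E. if x \<in> ?S then of_bool (f x) else 1)" for f
      unfolding prod.inter_restrict[OF finite_edge_pairs, symmetric] S
      using e[OF k] by (simp add: X_def)
    have "measure_pmf.expectation ?p (X k) = (\<Prod>x\<in>?E. measure_pmf.expectation (p x)
        (\<lambda>v. if x \<in> ?S then of_bool v else 1))"
      unfolding X_eq
      by (intro expectation_prod_Pi_pmf finite_edge_pairs measure_pmf.integrable_const_bound[where B = 1])
         auto
    also have "\<dots> = (\<Prod>x\<in>?E. if x \<in> ?S then measure_pmf.expectation (p x) (\<lambda>v. of_bool v) else 1)"
      by (intro prod.cong) auto
    also have "\<dots> = W (\<omega> i) (\<omega> k) * W (\<omega> j) (\<omega> k)"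
      unfolding prod.inter_restrict[OF finite_edge_pairs, symmetric] S
      using e[OF k] k ij by (simp add: W)
    finally show ?thesis .
  qed
  have row: "real n * row_inner n (adjacency_matrix f i) (adjacency_matrix f j) = (\<Sum>k\<in>?K. X k f)" for f
  proof -
    have "real n * row_inner n (adjacency_matrix f i) (adjacency_matrix f j) =
        (\<Sum>k\<in>{1..n}. adjacency_matrix f i k * adjacency_matrix f j k)"
      using n by (simp add: row_inner_def)
    \<comment> \<open>The omitted terms \<open>k = i\<close> and \<open>k = j\<close> contain a
      diagonal entry of the matrix, which is zero.\<close>
    also have "\<dots> = (\<Sum>k\<in>?K. adjacency_matrix f i k * adjacency_matrix f j k)"
      by (intro sum.mono_neutral_right) (auto simp: adjacency_matrix_def)
    also have "\<dots> = (\<Sum>k\<in>?K. X k f)"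
      by (intro sum.cong) (auto simp: adjacency_matrix_def X_def e_def min_def max_def)
    finally show ?thesis .
  qed
  have "measure_pmf.prob ?p {f \<in> space (measure_pmf ?p). sqrt (2 * real n * ln (real n)) \<le>
      \<bar>(\<Sum>k\<in>?K. X k f) - (\<Sum>k\<in>?K. measure_pmf.expectation ?p (X k))\<bar>} \<le> 2 / real n ^ 4"
    using K n by (intro prob_space.Hoeffding_sqrt_log[OF prob_space_measure_pmf] indep) (auto simp: X_def)
  also have "(\<Sum>k\<in>?K. measure_pmf.expectation ?p (X k)) = (\<Sum>k\<in>?K. W (\<omega> i) (\<omega> k) * W (\<omega> j) (\<omega> k))"
    by (intro sum.cong refl E)
  finally show ?thesis
    by (simp add: adjacency_pmf_def p_def[symmetric] vimage_def row del: One_nat_def)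
qed

section \<open>Both deviations under the joint law\<close>

text \<open>Extends the rectangle formula \<open>emeasure_W_random_graph\<close> to sets whose
  section varies with \<open>\<omega>\<close>, such as the event that the edges deviate.\<close>

lemma emeasure_W_random_graph_section:
  assumes B: "B \<in> sets ((\<Pi>\<^sub>M i\<in>{1..n}. M) \<Otimes>\<^sub>M count_space UNIV)"
  shows "emeasure (W_random_graph n M W) B =
    (\<integral>\<^sup>+\<omega>. emeasure (measure_pmf (adjacency_pmf n W \<omega>)) (Pair \<omega> -` B) \<partial>(\<Pi>\<^sub>M i\<in>{1..n}. M))"
  unfolding W_random_graph_def emeasure_bind[OF space_PiM_nonempty measurable_W_random_graph_kernel B]
  using B by (intro nn_integral_cong, subst emeasure_distr)
    (auto simp: space_pair_measure simp del: One_nat_def)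

text \<open>The intermediate sum is the conditional mean of
  \<open>n * row_inner n (A i) (A j)\<close> given the positions, so the two alternatives separate
  the randomness of the positions from that of the edges.\<close>

definition deviates :: "nat \<Rightarrow> (nat \<Rightarrow> 'a) \<Rightarrow> (nat \<Rightarrow> nat \<Rightarrow> real) \<Rightarrow> nat \<Rightarrow> nat \<Rightarrow> bool" where
  "deviates n \<omega> A i j \<longleftrightarrow>
     sqrt (2 * real n * ln (real n)) \<le>
       \<bar>(\<Sum>k\<in>{1..n} - {i, j}. W (\<omega> i) (\<omega> k) * W (\<omega> j) (\<omega> k)) - real (n - 2) * W_inner (\<omega> i) (\<omega> j)\<bar> \<or>
     sqrt (2 * real n * ln (real n)) \<le>
       \<bar>real n * row_inner n (A i) (A j) - (\<Sum>k\<in>{1..n} - {i, j}. W (\<omega> i) (\<omega> k) * W (\<omega> j) (\<omega> k))\<bar>"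

text \<open>Each kind of deviation costs at most \<open>2 / n ^ 2\<close>, the tail
  \<open>2 / n ^ 4\<close> times at most \<open>n ^ 2\<close> pairs. The event on positions is a
  cylinder; the one on edges is bounded section by section.\<close>

lemma prob_deviates_le:
  assumes n: "3 \<le> n"
  shows "{x \<in> space (W_random_graph n M W). \<exists>i\<in>{1..n}. \<exists>j\<in>{1..n}. i \<noteq> j \<and> deviates n (fst x) (snd x) i j}
      \<in> sets (W_random_graph n M W) \<and>
    measure (W_random_graph n M W) {x \<in> space (W_random_graph n M W).
      \<exists>i\<in>{1..n}. \<exists>j\<in>{1..n}. i \<noteq> j \<and> deviates n (fst x) (snd x) i j} \<le> 4 / real n ^ 2"
proof -
  let ?P = "\<Pi>\<^sub>M i\<in>{1..n}. M"
  let ?G = "W_random_graph n M W"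
  let ?N = "?P \<Otimes>\<^sub>M count_space (UNIV :: (nat \<Rightarrow> nat \<Rightarrow> real) set)"
  define Q1 where "Q1 i j \<omega> \<longleftrightarrow> sqrt (2 * real n * ln (real n)) \<le>
    \<bar>(\<Sum>k\<in>{1..n} - {i, j}. W (\<omega> i) (\<omega> k) * W (\<omega> j) (\<omega> k)) - real (n - 2) * W_inner (\<omega> i) (\<omega> j)\<bar>"
    for i j \<omega>
  define Q2 where "Q2 i j \<omega> A \<longleftrightarrow> sqrt (2 * real n * ln (real n)) \<le>
    \<bar>real n * row_inner n (A i) (A j) - (\<Sum>k\<in>{1..n} - {i, j}. W (\<omega> i) (\<omega> k) * W (\<omega> j) (\<omega> k))\<bar>"
    for i j \<omega> A
  define B1 where "B1 = {\<omega> \<in> space ?P. \<exists>i\<in>{1..n}. \<exists>j\<in>{1..n}. i \<noteq> j \<and> Q1 i j \<omega>}"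
  define B2 where "B2 = {x \<in> space ?N. \<exists>i\<in>{1..n}. \<exists>j\<in>{1..n}. i \<noteq> j \<and> Q2 i j (fst x) (snd x)}"
  interpret P: prob_space ?P
    by (intro prob_space_PiM) (rule prob_space_axioms)
  interpret G: prob_space ?G
    by (rule prob_space_W_random_graph)
  have Q1: "{\<omega> \<in> space ?P. Q1 i j \<omega>} \<in> sets ?P \<and> P.prob {\<omega> \<in> space ?P. Q1 i j \<omega>} \<le> 2 / real n ^ 4"
    if "i \<in> {1..n}" "j \<in> {1..n}" "i \<noteq> j" for i j
    unfolding Q1_def by (rule latent_deviation_pair[OF n that])
  have B1: "B1 \<in> sets ?P"
    unfolding B1_def
  proof (intro sets.sets_Collect_finite_Ex)
    fix i j assume "i \<in> {1..n}" "j \<in> {1..n}"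
    then show "{\<omega> \<in> space ?P. i \<noteq> j \<and> Q1 i j \<omega>} \<in> sets ?P"
      using Q1[of i j] by (cases "i = j") (auto simp del: One_nat_def)
  qed auto
  have pB1: "P.prob B1 \<le> 2 / real n ^ 2"
    unfolding B1_def by (intro P.prob_Ex_pair_le Q1) auto
  have meas: "{x \<in> space ?N. Q2 i j (fst x) (snd x)} \<in> sets ?N"
    if "i \<in> {1..n}" "j \<in> {1..n}" "i \<noteq> j" for i j
  proof -
    \<comment> \<open>The matrix component carries the discrete sigma-algebra, so every function of
      it is measurable.\<close>
    have [measurable]: "(\<lambda>x. row_inner n (snd x i) (snd x j)) \<in> borel_measurable ?N"
      by (rule measurable_compose[OF measurable_snd]) simp
    have [measurable]: "(\<lambda>x. fst x k) \<in> measurable ?N M" if "k \<in> {1..n}" for k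
      using that by measurable
    have [measurable]: "(\<lambda>x. \<Sum>k\<in>{1..n} - {i, j}. W (fst x i) (fst x k) * W (fst x j) (fst x k))
        \<in> borel_measurable ?N"
      using that by (intro borel_measurable_sum borel_measurable_times measurable_W_compose) auto
    show ?thesis
      unfolding Q2_def by measurable
  qed
  have B2: "B2 \<in> sets ?N"
    unfolding B2_def
  proof (intro sets.sets_Collect_finite_Ex)
    fix i j assume "i \<in> {1..n}" "j \<in> {1..n}"
    then show "{x \<in> space ?N. i \<noteq> j \<and> Q2 i j (fst x) (snd x)} \<in> sets ?N"
      using meas[of i j] by (cases "i = j") (auto simp del: One_nat_def)
  qed auto
  have "emeasure ?G (B1 \<times> UNIV) = emeasure ?P B1"
    using B1 by (simp add: emeasure_W_random_graph measure_pmf.emeasure_space_1[simplified])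
  then have gB1: "G.prob (B1 \<times> UNIV) \<le> 2 / real n ^ 2"
    using pB1 by (simp add: G.emeasure_eq_measure P.emeasure_eq_measure del: One_nat_def)
  have "emeasure ?G B2 = (\<integral>\<^sup>+\<omega>. emeasure (measure_pmf (adjacency_pmf n W \<omega>)) (Pair \<omega> -` B2) \<partial>?P)"
    by (rule emeasure_W_random_graph_section[OF B2])
  also have "\<dots> \<le> (\<integral>\<^sup>+\<omega>. ennreal (2 / real n ^ 2) \<partial>?P)"
  proof (rule nn_integral_mono)
    fix \<omega> assume \<omega>: "\<omega> \<in> space ?P"
    let ?p = "measure_pmf (adjacency_pmf n W \<omega>)"
    have "Pair \<omega> -` B2 = {A \<in> space ?p. \<exists>i\<in>{1..n}. \<exists>j\<in>{1..n}. i \<noteq> j \<and> Q2 i j \<omega> A}"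
      using \<omega> by (auto simp: B2_def space_pair_measure simp del: One_nat_def)
    moreover have "measure ?p {A \<in> space ?p. \<exists>i\<in>{1..n}. \<exists>j\<in>{1..n}. i \<noteq> j \<and> Q2 i j \<omega> A} \<le> 2 / real n ^ 2"
      using conditional_deviation_pair[OF n \<omega>]
      by (intro prob_space.prob_Ex_pair_le[OF prob_space_measure_pmf]) (auto simp: Q2_def simp del: One_nat_def)
    ultimately show "emeasure ?p (Pair \<omega> -` B2) \<le> ennreal (2 / real n ^ 2)"
      by (simp add: measure_pmf.emeasure_eq_measure ennreal_leI)
  qed
  also have "\<dots> = ennreal (2 / real n ^ 2)"
    by (simp add: P.emeasure_space_1 del: One_nat_def)
  finally have gB2: "G.prob B2 \<le> 2 / real n ^ 2"
    by (simp add: G.emeasure_eq_measure)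
  have sp: "space ?G = space ?P \<times> UNIV"
    using sets_eq_imp_space_eq[OF sets_W_random_graph[of n]] by (simp add: space_pair_measure)
  have un: "{x \<in> space ?G. \<exists>i\<in>{1..n}. \<exists>j\<in>{1..n}. i \<noteq> j \<and> deviates n (fst x) (snd x) i j} = B1 \<times> UNIV \<union> B2"
    unfolding sp B1_def B2_def deviates_def Q1_def[symmetric] Q2_def[symmetric]
    by (simp add: set_eq_iff space_pair_measure del: One_nat_def atLeastAtMost_iff) blast
  have sets: "B1 \<times> UNIV \<in> sets ?G" "B2 \<in> sets ?G"
    using B1 B2 unfolding sets_W_random_graph by auto
  have "G.prob (B1 \<times> UNIV \<union> B2) \<le> G.prob (B1 \<times> UNIV) + G.prob B2"
    using sets by (rule measure_Un_le)
  then show ?thesis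
    unfolding un using sets gB1 gB2 by auto
qed

text \<open>On the scale of sums the error is at most two thresholds, plus \<open>2\<close> for
  having \<open>n - 2\<close> instead of \<open>n\<close> copies of \<open>W_inner\<close>. By
  \<open>sqrt 2 \<le> 3 / 2\<close> this is at most \<open>3 * sqrt (n * ln n) + 2\<close>, and the
  \<open>2\<close> is absorbed because \<open>sqrt (n * ln n)\<close> is at least one; dividing by
  \<open>n\<close> gives the factor \<open>5\<close>.\<close>

lemma row_inner_close:
  assumes n: "3 \<le> n" and "x \<in> space M" "y \<in> space M"
    and 1: "\<not> sqrt (2 * real n * ln (real n)) \<le> \<bar>s - real (n - 2) * W_inner x y\<bar>"
    and 2: "\<not> sqrt (2 * real n * ln (real n)) \<le> \<bar>real n * r - s\<bar>"
  shows "\<bar>r - W_inner x y\<bar> \<le> 5 * sqrt (ln (real n) / real n)"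
proof -
  have "(1 :: real) < ln 3"
    using exp_le ln3_gt_1 by simp
  also have "ln 3 \<le> ln (real n)"
    using n by simp
  finally have ln: "1 < ln (real n)" .
  let ?s = "sqrt (ln (real n) / real n)"
  have s: "real n * ?s = sqrt (real n * ln (real n))"
    using n by (simp add: real_sqrt_divide real_sqrt_mult field_simps)
  have "sqrt 2 \<le> 3 / 2"
    by (rule real_le_lsqrt) (auto simp: power2_eq_square)
  then have \<epsilon>: "sqrt (2 * real n * ln (real n)) \<le> 3 / 2 * (real n * ?s)"
    unfolding s using ln n by (simp add: real_sqrt_mult mult.assoc mult_right_mono)
  have "1 \<le> real n * ln (real n)"
    using mult_mono[of 1 "real n" 1 "ln (real n)"] ln n by simp
  then have one: "1 \<le> real n * ?s"
    unfolding s by simp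
  have "\<bar>real n * r - real n * W_inner x y\<bar> \<le> 2 * (3 / 2 * (real n * ?s)) + 2"
  proof -
    have "real n * W_inner x y = real (n - 2) * W_inner x y + 2 * W_inner x y"
      using n by (simp add: of_nat_diff algebra_simps)
    then show ?thesis
      using 1 2 \<epsilon> W_inner_bounds[OF assms(2,3)] by linarith
  qed
  also have "\<dots> \<le> real n * (5 * ?s)"
    using one by simp
  finally have "real n * \<bar>r - W_inner x y\<bar> \<le> real n * (5 * ?s)"
    by (simp add: abs_mult flip: right_diff_distrib)
  then show ?thesis
    using n by simp
qed

section \<open>Measurability and probability of the accurate event\<close>

definition estimator_accurate :: "real \<Rightarrow> nat \<Rightarrow> (nat \<Rightarrow> 'a) \<Rightarrow> (nat \<Rightarrow> nat \<Rightarrow> real) \<Rightarrow>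
    (nat \<Rightarrow> nat) \<Rightarrow> (nat \<Rightarrow> nat) \<Rightarrow> nat \<Rightarrow> nat \<Rightarrow> bool" where
  "estimator_accurate C n \<omega> A m mh i j \<longleftrightarrow>
     \<bar>(neighborhood_dist M W (\<omega> i) (\<omega> j))\<^sup>2 - dist_sq_estimator n A mh i j\<bar>
       \<le> C * (neighborhood_dist M W (\<omega> j) (\<omega> (m j)) + neighborhood_dist M W (\<omega> i) (\<omega> (m i))
              + sqrt (ln (real n) / real n))"

text \<open>
  The quantification over selections is uncountable, but only their restrictions to \<open>{1..n}\<close>
  matter, and there are finitely many of these.
\<close>

lemma sets_accurate_event:
  "{x \<in> space (W_random_graph n M W). \<forall>m mh. nearest_neighbor n M W (fst x) m \<longrightarrow>
      empirical_neighbor n (snd x) mh \<longrightarrow>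
      (\<forall>i\<in>{1..n}. \<forall>j\<in>{1..n}. i \<noteq> j \<longrightarrow> estimator_accurate C n (fst x) (snd x) m mh i j)}
    \<in> sets (W_random_graph n M W)"
proof -
  let ?P = "\<Pi>\<^sub>M i\<in>{1..n}. M"
  let ?N = "?P \<Otimes>\<^sub>M count_space (UNIV :: (nat \<Rightarrow> nat \<Rightarrow> real) set)"
  let ?F = "{1..n} \<rightarrow>\<^sub>E {1..n}"
  have sp: "space (W_random_graph n M W) = space ?N"
    by (rule sets_eq_imp_space_eq[OF sets_W_random_graph])
  have coord: "(\<lambda>x. fst x k) \<in> measurable ?N M" if "k \<in> {1..n}" for k
    using that by measurable
  have dist: "(\<lambda>x. neighborhood_dist M W (fst x a) (fst x b)) \<in> borel_measurable ?N"
    if "a \<in> {1..n}" "b \<in> {1..n}" for a b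
  proof -
    note [measurable] = coord[OF that(1)] coord[OF that(2)]
    show ?thesis
      unfolding neighborhood_dist_def by measurable
  qed
  have "(\<forall>m mh. nearest_neighbor n M W \<omega> m \<longrightarrow> empirical_neighbor n A mh \<longrightarrow>
      (\<forall>i\<in>{1..n}. \<forall>j\<in>{1..n}. i \<noteq> j \<longrightarrow> estimator_accurate C n \<omega> A m mh i j)) \<longleftrightarrow>
    (\<forall>m\<in>?F. \<forall>mh\<in>?F. nearest_neighbor n M W \<omega> m \<longrightarrow> empirical_neighbor n A mh \<longrightarrow>
      (\<forall>i\<in>{1..n}. \<forall>j\<in>{1..n}. i \<noteq> j \<longrightarrow> estimator_accurate C n \<omega> A m mh i j))"
    (is "_ \<longleftrightarrow> ?R") for \<omega> A
  proof (intro iffI allI impI ballI)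
    fix m mh i j
    assume R: ?R and m: "nearest_neighbor n M W \<omega> m" and mh: "empirical_neighbor n A mh"
      and ij: "i \<in> {1..n}" "j \<in> {1..n}" "i \<noteq> j"
    have "restrict m {1..n} \<in> ?F" "restrict mh {1..n} \<in> ?F"
      using nearest_neighbor_range[OF m] empirical_neighbor_range[OF mh]
      by (auto simp del: One_nat_def atLeastAtMost_iff)
    then have "estimator_accurate C n \<omega> A (restrict m {1..n}) (restrict mh {1..n}) i j"
      using R ij m mh
      by (simp add: nearest_neighbor_restrict empirical_neighbor_restrict del: One_nat_def atLeastAtMost_iff)
    then show "estimator_accurate C n \<omega> A m mh i j"
      using ij by (simp add: estimator_accurate_def dist_sq_estimator_def)
  qed blast
  moreover have "{x \<in> space ?N. \<forall>m\<in>?F. \<forall>mh\<in>?F. nearest_neighbor n M W (fst x) m \<longrightarrow>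
      empirical_neighbor n (snd x) mh \<longrightarrow>
      (\<forall>i\<in>{1..n}. \<forall>j\<in>{1..n}. i \<noteq> j \<longrightarrow> estimator_accurate C n (fst x) (snd x) m mh i j)} \<in> sets ?N"
  proof (intro sets.sets_Collect_finite_All sets.sets_Collect_imp sets.sets_Collect_const finite_PiE)
    fix m mh assume m: "m \<in> ?F" and mh: "mh \<in> ?F"
    \<comment> \<open>Since \<open>m\<close> takes values in \<open>{1..n}\<close>, minimality is a
      finite conjunction of inequalities between measurable distances.\<close>
    have "{x \<in> space ?N. nearest_neighbor n M W (fst x) m} =
        {x \<in> space ?N. \<forall>i\<in>{1..n}. m i \<noteq> i \<and> (\<forall>t\<in>{1..n} - {i}.
          neighborhood_dist M W (fst x i) (fst x (m i)) \<le> neighborhood_dist M W (fst x i) (fst x t))}"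
      using m unfolding nearest_neighbor_def is_arg_min_linorder
      by (intro Collect_cong conj_cong ball_cong refl) (auto simp del: One_nat_def atLeastAtMost_iff)
    also have "\<dots> \<in> sets ?N"
      using m by (intro sets.sets_Collect_finite_All sets.sets_Collect_conj sets.sets_Collect_const
          borel_measurable_le dist) (auto simp del: One_nat_def)
    finally show "{x \<in> space ?N. nearest_neighbor n M W (fst x) m} \<in> sets ?N" .
    show "{x \<in> space ?N. empirical_neighbor n (snd x) mh} \<in> sets ?N"
    proof -
      have "Measurable.pred ?N (\<lambda>x. empirical_neighbor n (snd x) mh)"
        by (rule measurable_compose[OF measurable_snd]) simp
      then show ?thesis
        by measurable
    qed
    fix i j assume ij: "i \<in> {1..n}" "j \<in> {1..n}"
    have [measurable]: "(\<lambda>x. dist_sq_estimator n (snd x) mh i j) \<in> borel_measurable ?N"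
      by (rule measurable_compose[OF measurable_snd]) simp
    have mij: "m i \<in> {1..n}" "m j \<in> {1..n}"
      using m ij by auto
    note [measurable] = dist[OF ij] dist[OF ij(1) mij(1)] dist[OF ij(2) mij(2)]
    show "{x \<in> space ?N. estimator_accurate C n (fst x) (snd x) m mh i j} \<in> sets ?N"
      unfolding estimator_accurate_def by measurable
  qed auto
  ultimately show ?thesis
    unfolding sp sets_W_random_graph by simp
qed

lemma prob_estimator_accurate:
  assumes n: "3 \<le> n"
  shows "1 - 4 / real n ^ 2 \<le> measure (W_random_graph n M W) {x \<in> space (W_random_graph n M W).
    \<forall>m mh. nearest_neighbor n M W (fst x) m \<longrightarrow> empirical_neighbor n (snd x) mh \<longrightarrow>
      (\<forall>i\<in>{1..n}. \<forall>j\<in>{1..n}. i \<noteq> j \<longrightarrow> estimator_accurate 60 n (fst x) (snd x) m mh i j)}"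
    (is "_ \<le> measure ?G ?A")
proof -
  interpret G: prob_space ?G
    by (rule prob_space_W_random_graph)
  let ?B = "{x \<in> space ?G. \<exists>i\<in>{1..n}. \<exists>j\<in>{1..n}. i \<noteq> j \<and> deviates n (fst x) (snd x) i j}"
  let ?s = "sqrt (ln (real n) / real n)"
  have sp: "space ?G = space (\<Pi>\<^sub>M i\<in>{1..n}. M) \<times> UNIV"
    using sets_eq_imp_space_eq[OF sets_W_random_graph[of n]] by (simp add: space_pair_measure)
  have "space ?G - ?B \<subseteq> ?A"
  proof safe
    fix \<omega> A m mh i j
    assume x: "(\<omega>, A) \<in> space ?G"
      and nB: "\<not> (\<exists>i\<in>{1..n}. \<exists>j\<in>{1..n}. i \<noteq> j \<and> deviates n (fst (\<omega>, A)) (snd (\<omega>, A)) i j)"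
      and m: "nearest_neighbor n M W (fst (\<omega>, A)) m" and mh: "empirical_neighbor n (snd (\<omega>, A)) mh"
      and ij: "i \<in> {1..n}" "j \<in> {1..n}" "i \<noteq> j"
    have \<omega>: "\<omega> k \<in> space M" if "k \<in> {1..n}" for k
      using x that unfolding sp by (auto simp: space_PiM PiE_iff)
    have "\<bar>row_inner n (A k) (A l) - W_inner (\<omega> k) (\<omega> l)\<bar> \<le> 5 * ?s"
      if "k \<in> {1..n}" "l \<in> {1..n}" "k \<noteq> l" for k l
    proof -
      have "\<not> deviates n \<omega> A k l"
        using nB that unfolding fst_conv snd_conv by blast
      then show ?thesis
        unfolding deviates_def using row_inner_close[OF n \<omega> \<omega>, OF that(1,2)] by blast
    qed
    \<comment> \<open>With \<open>\<delta> = 5 * ?s\<close> the error \<open>12 * \<delta>\<close>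
      yields the constant \<open>60\<close>, which also dominates the factor \<open>2\<close> of the
      nonnegative neighbor distances.\<close>
    from dist_sq_estimator_error[where \<omega> = \<omega>, OF n \<omega> this _ _ ij, of m mh] m mh
    have "\<bar>(neighborhood_dist M W (\<omega> i) (\<omega> j))\<^sup>2 - dist_sq_estimator n A mh i j\<bar> \<le>
        2 * neighborhood_dist M W (\<omega> j) (\<omega> (m j)) + 2 * neighborhood_dist M W (\<omega> i) (\<omega> (m i)) + 12 * (5 * ?s)"
      by simp
    then show "estimator_accurate 60 n (fst (\<omega>, A)) (snd (\<omega>, A)) m mh i j"
      using neighborhood_dist_nonneg[of "\<omega> i" "\<omega> (m i)"] neighborhood_dist_nonneg[of "\<omega> j" "\<omega> (m j)"]
      by (simp add: estimator_accurate_def)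
  qed
  then have "G.prob (space ?G - ?B) \<le> G.prob ?A"
    by (intro G.finite_measure_mono sets_accurate_event)
  moreover have "G.prob (space ?G - ?B) = 1 - G.prob ?B"
    by (rule G.prob_compl[OF prob_deviates_le[OF n, THEN conjunct1]])
  ultimately show ?thesis
    using prob_deviates_le[OF n, THEN conjunct2] by linarith
qed

end

theorem theorem1:
  shows "\<exists>C::real. \<forall>n::nat. n \<ge> 1 \<longrightarrow> (\<forall>(M :: 'a measure) W. graphon M W \<longrightarrow>
    \<P>((\<omega>, A) in W_random_graph n M W.
      \<forall>m mh. nearest_neighbor n M W \<omega> m \<longrightarrow> empirical_neighbor n A mh \<longrightarrow>
        (\<forall>i\<in>{1..n}. \<forall>j\<in>{1..n}. i \<noteq> j \<longrightarrow>
          \<bar>(neighborhood_dist M W (\<omega> i) (\<omega> j))\<^sup>2 - dist_sq_estimator n A mh i j\<bar>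
            \<le> C * (neighborhood_dist M W (\<omega> j) (\<omega> (m j))
                  + neighborhood_dist M W (\<omega> i) (\<omega> (m i))
                  + sqrt (ln (real n) / real n))))
    \<ge> 1 - 2 / real n)"
proof (intro exI[of _ "60 :: real"] allI impI)
  fix n :: nat and M :: "'a measure" and W
  assume n: "1 \<le> n" and "graphon M W"
  then interpret graphon M W
    by simp
  show "\<P>((\<omega>, A) in W_random_graph n M W.
      \<forall>m mh. nearest_neighbor n M W \<omega> m \<longrightarrow> empirical_neighbor n A mh \<longrightarrow>
        (\<forall>i\<in>{1..n}. \<forall>j\<in>{1..n}. i \<noteq> j \<longrightarrow>
          \<bar>(neighborhood_dist M W (\<omega> i) (\<omega> j))\<^sup>2 - dist_sq_estimator n A mh i j\<bar>
            \<le> 60 * (neighborhood_dist M W (\<omega> j) (\<omega> (m j))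
                  + neighborhood_dist M W (\<omega> i) (\<omega> (m i))
                  + sqrt (ln (real n) / real n)))) \<ge> 1 - 2 / real n" (is "?p \<ge> _")
  proof (cases "3 \<le> n")
    case True
    \<comment> \<open>The concentration bound \<open>1 - 4 / n ^ 2\<close> is at least the claimed
      one as soon as \<open>n\<close> is two or more.\<close>
    have "4 / real n ^ 2 \<le> 2 / real n"
      using True by (simp add: field_simps power2_eq_square)
    then show ?thesis
      using prob_estimator_accurate[OF True]
      by (simp add: estimator_accurate_def case_prod_beta' del: One_nat_def)
  next
    case False
    \<comment> \<open>For \<open>n\<close> equal to one or two the claimed lower bound is
      nonpositive, and any probability meets it.\<close>
    then have "1 - 2 / real n \<le> 0"
      using n by (simp add: field_simps)
    also have "0 \<le> ?p"
      by (rule measure_nonneg)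
    finally show ?thesis .
  qed
qed

end
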